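(* Let $z\in\mathbb{C}$ with $\operatorname{Re} z>1$ and let $a>0$. Then the complex exponential B-spline $E_z^a$ possesses the time domain representation $$E_z^a(x)=\frac{1}{\Gamma(z)}\sum_{\ell=0}^\infty \binom{z}{\ell}(-1)^\ell e^{-\ell a}\, e_+^{-a(x-\ell)}\,(x-\ell)_+^{z-1},$$ where the sum converges both point-wise in $\mathbb{R}$ and in the $L^2(\mathbb{R})$-sense.
   Context: The Fourier transform is $\widehat f(\omega)=\int_{\mathbb{R}} f(x)e^{-i\omega x}\,dx$ (extended to $L^2(\mathbb{R})$). For $a>0$ and $\omega\in\mathbb{R}$ put $\Omega(\omega,a):=\frac{1-e^{-(a+i\omega)}}{a+i\omega}$; its values avoid the negative real axis. The complex exponential B-spline $E_z^a$ of order $z$ ($\operatorname{Re} z>1$) is the function defined in the Fourier domain by $\widehat{E_z^a}(\omega):=\Omega(\omega,a)^z$, with the power taken on the principal branch of the logarithm. The complex binomial is $\binom{z}{\ell}=\frac{\Gamma(z+1)}{\Gamma(\ell+1)\Gamma(z-\ell+1)}$ (with $1/\Gamma=0$ at the poles of $\Gamma$). The truncated power is $x_+^{w}=e^{w\ln x}$ for $x>0$ and $x_+^{w}=0$ for $x\le 0$. The truncated exponential is $e_+^{-at}:=\chi_{[0,\infty)}(t)\,e^{-at}$, so $e_+^{-a(x-\ell)}=\chi_{[0,\infty)}(x-\ell)\,e^{-a(x-\ell)}$. *)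

theory Defs
  imports "HOL-Analysis.Analysis"
begin

definition square_integrable :: "(real \<Rightarrow> complex) \<Rightarrow> bool" where
  "square_integrable f \<longleftrightarrow>
     f \<in> borel_measurable lborel \<and> integrable lborel (\<lambda>x. (cmod (f x))\<^sup>2)"

text \<open>The membership conditions make every integrand below integrable, so that the default
  value 0 of the Bochner integral never plays a role.\<close>

definition L2_converges :: "(nat \<Rightarrow> real \<Rightarrow> complex) \<Rightarrow> (real \<Rightarrow> complex) \<Rightarrow> bool" where
  "L2_converges F f \<longleftrightarrow>
     (\<forall>n. square_integrable (F n)) \<and> square_integrable f \<and>
     (\<lambda>n. LINT x|lborel. (cmod (F n x - f x))\<^sup>2) \<longlonglongrightarrow> 0"

definition fourier_L1 :: "(real \<Rightarrow> complex) \<Rightarrow> real \<Rightarrow> complex" where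
  "fourier_L1 f \<omega> = (LINT x|lborel. f x * exp (- \<i> * of_real \<omega> * of_real x))"

text \<open>The extension of the Fourier transform to square-integrable functions, as a relation between
  representatives: \<open>g\<close> is a Fourier transform of \<open>f\<close> if it is the \<open>L\<^sup>2\<close>-limit of the transforms
  of some integrable functions that converge to \<open>f\<close> in \<open>L\<^sup>2\<close>.\<close>

definition is_fourier_L2 :: "(real \<Rightarrow> complex) \<Rightarrow> (real \<Rightarrow> complex) \<Rightarrow> bool" where
  "is_fourier_L2 f g \<longleftrightarrow>
     (\<exists>F. (\<forall>n. integrable lborel (F n)) \<and> L2_converges F f \<and>
          L2_converges (\<lambda>n. fourier_L1 (F n)) g)"

definition Omega :: "real \<Rightarrow> real \<Rightarrow> complex" where
  "Omega \<omega> a = (1 - exp (- (of_real a + \<i> * of_real \<omega>))) / (of_real a + \<i> * of_real \<omega>)"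

text \<open>The Fourier transform fixes the spline only up to a null set; pointwise statements refer to
  its unique continuous representative. On complex numbers \<open>powr\<close> is the principal power.\<close>

definition exp_bspline :: "complex \<Rightarrow> real \<Rightarrow> real \<Rightarrow> complex" where
  "exp_bspline z a =
     (THE E. continuous_on UNIV E \<and> is_fourier_L2 E (\<lambda>\<omega>. Omega \<omega> a powr z))"

text \<open>\<open>rGamma\<close> is \<open>1 / \<Gamma>\<close>, extended by 0 to the poles of \<open>\<Gamma>\<close>.\<close>

definition complex_binomial :: "complex \<Rightarrow> nat \<Rightarrow> complex" where
  "complex_binomial z l = Gamma (z + 1) * rGamma (of_nat l + 1) * rGamma (z - of_nat l + 1)"

definition trunc_power :: "real \<Rightarrow> complex \<Rightarrow> complex" where
  "trunc_power x w = (if x > 0 then exp (w * of_real (ln x)) else 0)"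

definition trunc_exp :: "real \<Rightarrow> real \<Rightarrow> real" where
  "trunc_exp a t = indicator {0..} t * exp (- a * t)"

definition bspline_term :: "complex \<Rightarrow> real \<Rightarrow> nat \<Rightarrow> real \<Rightarrow> complex" where
  "bspline_term z a l x =
     complex_binomial z l * (-1) ^ l * of_real (exp (- real l * a)) *
     of_real (trunc_exp a (x - real l)) * trunc_power (x - real l) (z - 1)"

end

theory Submission
  imports Defs "HOL-Probability.Probability" "HOL-Real_Asymp.Real_Asymp"
begin

text \<open>
  Write \<open>s = a + \<i> \<omega>\<close>. Since \<open>s\<close> and \<open>1 - exp (- s)\<close> both lie in the right half-plane, the principal
  power of their quotient splits, \<open>Omega \<omega> a powr z
      = (1 - exp (- s)) powr z * s powr (- z)\<close>. The second
  factor is the Fourier transform of the gamma kernel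
  \<open>g x = x\<^sub>+ powr (z - 1) * exp (- a * x) / Gamma z\<close> (lemma \<open>fourier_gamma_kernel\<close>). The first one expands
  into a binomial series in \<open>exp (- s) = exp (- a) * exp (- \<i> \<omega>)\<close>, which converges absolutely and
  uniformly in \<open>\<omega>\<close> because \<open>a > 0\<close>. As \<open>exp (- \<i> \<omega>)\<close> is the symbol of the translation by one, the
  spline must be the series of the translates \<open>g (x - l)\<close> with the coefficients
  \<open>(z gchoose l) * (- exp (- a)) ^ l\<close>, and this is the claimed formula.
  
  To make this rigorous, let \<open>E\<close> be the sum of that series. It is finite at every point, because \<open>g\<close>
  vanishes on the negative half-line, and continuous, because \<open>Re z > 1\<close> makes \<open>g\<close> continuous. Its
  partial sums are integrable. They converge to \<open>E\<close> in \<open>L\<^sup>2\<close> (\<open>L2_converges_shift_series\<close>), and their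
  transforms converge in \<open>L\<^sup>2\<close> to \<open>Omega \<omega> a powr z\<close> (\<open>L2_converges_fourier_partial_sums\<close>), both by
  dominated convergence. Hence \<open>E\<close> is a continuous function with the required transform.
  
  The spline is defined by a definite description, so it remains to see that \<open>E\<close> is the only such
  function (\<open>is_fourier_L2_continuous_unique\<close>). By the multiplication formula the pairings of \<open>E\<close> with
  Gaussians, which are transforms of modulated Gaussians, depend only on the transform of \<open>E\<close>; and
  narrow Gaussians recover the value of a continuous function at every point.
  
  The transform of \<open>g\<close> requires Euler's integral at the complex rate \<open>s\<close> (\<open>laplace_trunc_power\<close>). It is
  derived from the integral at a real rate \<open>r\<close> with \<open>\<bar>s - r\<bar> < r\<close> by integrating the power series of
  \<open>exp (- (s - r) * t)\<close> term by term, which again produces a binomial series.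
\<close>

section \<open>Square integrable functions\<close>

lemma square_integrable_mult_integrable:
  assumes "square_integrable f" "square_integrable g"
  shows "integrable lborel (\<lambda>x. f x * g x)"
proof (rule Bochner_Integration.integrable_bound)
  show "integrable lborel (\<lambda>x. (cmod (f x))\<^sup>2 + (cmod (g x))\<^sup>2)"
    using assms by (auto simp: square_integrable_def)
  show "(\<lambda>x. f x * g x) \<in> borel_measurable lborel"
    using assms by (auto simp: square_integrable_def)
  have "u * v \<le> u\<^sup>2 + v\<^sup>2" for u v :: real
    using sum_squares_bound[of u v] zero_le_power2[of u] zero_le_power2[of v] by linarith
  then show "AE x in lborel. norm (f x * g x) \<le> norm ((cmod (f x))\<^sup>2 + (cmod (g x))\<^sup>2)"
    by (simp add: norm_mult)
qed

lemma norm_diff_square_le: "(cmod (u - v))\<^sup>2 \<le> 2 * (cmod u)\<^sup>2 + 2 * (cmod v)\<^sup>2"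
proof -
  have "(cmod (u - v))\<^sup>2 \<le> (cmod u + cmod v)\<^sup>2"
    by (intro power_mono norm_triangle_ineq4) auto
  also have "\<dots> \<le> 2 * (cmod u)\<^sup>2 + 2 * (cmod v)\<^sup>2"
    using sum_squares_bound[of "cmod u" "cmod v"] by (simp add: power2_sum)
  finally show ?thesis .
qed

lemma square_integrable_diff:
  assumes "square_integrable f" "square_integrable g"
  shows "square_integrable (\<lambda>x. f x - g x)"
  unfolding square_integrable_def
proof
  show meas: "(\<lambda>x. f x - g x) \<in> borel_measurable lborel"
    using assms by (auto simp: square_integrable_def)
  show "integrable lborel (\<lambda>x. (cmod (f x - g x))\<^sup>2)"
  proof (rule Bochner_Integration.integrable_bound)
    show "integrable lborel (\<lambda>x. 2 * (cmod (f x))\<^sup>2 + 2 * (cmod (g x))\<^sup>2)"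
      using assms by (auto simp: square_integrable_def)
    show "(\<lambda>x. (cmod (f x - g x))\<^sup>2) \<in> borel_measurable lborel"
      using meas by measurable
    show "AE x in lborel. norm ((cmod (f x - g x))\<^sup>2)
        \<le> norm (2 * (cmod (f x))\<^sup>2 + 2 * (cmod (g x))\<^sup>2)"
      by (simp add: norm_diff_square_le)
  qed
qed

text \<open>
  Pairing with a fixed square integrable function is continuous for \<open>L\<^sup>2\<close> convergence.
\<close>

lemma L2_converges_pairing:
  assumes F: "L2_converges F f" and \<psi>: "square_integrable \<psi>"
  shows "(\<lambda>n. LINT x|lborel. F n x * \<psi> x) \<longlonglongrightarrow> (LINT x|lborel. f x * \<psi> x)"
proof -
  define A where "A n = (LINT x|lborel. (cmod (F n x - f x))\<^sup>2)" for n
  define B where "B = (LINT x|lborel. (cmod (\<psi> x))\<^sup>2)"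
  have Fn: "square_integrable (F n)" and f: "square_integrable f" for n
    using F by (auto simp: L2_converges_def)
  have A0: "A \<longlonglongrightarrow> 0" using F by (simp add: L2_converges_def A_def [abs_def])
  have D: "square_integrable (\<lambda>x. F n x - f x)" for n
    using Fn f by (rule square_integrable_diff)
  \<comment> \<open>Cauchy--Schwarz in its additive form: a weight \<open>t\<close> trades one factor against the other,
    and is later chosen large enough to make the constant part small.\<close>
  have bound: "cmod ((LINT x|lborel. F n x * \<psi> x) - (LINT x|lborel. f x * \<psi> x)) \<le> t * A n + B / t"
    if "t > 0" for t n
  proof -
    have "(LINT x|lborel. F n x * \<psi> x) - (LINT x|lborel. f x * \<psi> x)
        = (LINT x|lborel. (F n x - f x) * \<psi> x)"
      using square_integrable_mult_integrable[OF Fn \<psi>] square_integrable_mult_integrable[OF f \<psi>]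
      by (simp add: left_diff_distrib)
    also have "cmod \<dots> \<le> (LINT x|lborel. cmod ((F n x - f x) * \<psi> x))"
      by (rule integral_norm_bound)
    also have "\<dots> \<le> (LINT x|lborel. t * (cmod (F n x - f x))\<^sup>2 + (cmod (\<psi> x))\<^sup>2 / t)"
    proof (rule integral_mono)
      show "integrable lborel (\<lambda>x. cmod ((F n x - f x) * \<psi> x))"
        using square_integrable_mult_integrable[OF D \<psi>] by (rule integrable_norm)
      show "integrable lborel (\<lambda>x. t * (cmod (F n x - f x))\<^sup>2 + (cmod (\<psi> x))\<^sup>2 / t)"
        using D[of n] \<psi> by (auto simp: square_integrable_def)
      fix x
      have "u * v \<le> t * u\<^sup>2 + v\<^sup>2 / t" if "u \<ge> 0" "v \<ge> 0" for u v :: real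
      proof -
        have "0 \<le> (t * u - v)\<^sup>2 + t * u * v" using that \<open>t > 0\<close> by simp
        then have "t * (u * v) \<le> (t * u)\<^sup>2 + v\<^sup>2" by (simp add: power2_diff algebra_simps)
        then show ?thesis using \<open>t > 0\<close> by (simp add: field_simps power2_eq_square)
      qed
      then show "cmod ((F n x - f x) * \<psi> x) \<le> t * (cmod (F n x - f x))\<^sup>2 + (cmod (\<psi> x))\<^sup>2 / t"
        by (simp add: norm_mult)
    qed
    also have "\<dots> = t * A n + B / t"
      using D[of n] \<psi> by (auto simp: square_integrable_def A_def B_def)
    finally show ?thesis .
  qed
  show ?thesis
  proof (rule LIMSEQ_I)
    fix e :: real assume e: "e > 0"
    have B: "B \<ge> 0" by (simp add: B_def)
    define t where "t = 2 * (B + 1) / e"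
    have t: "t > 0" using B e by (simp add: t_def)
    have "B / t < e / 2" using B e by (simp add: t_def field_simps)
    have "e / (2 * t) > 0" using e t by simp
    with A0 obtain N where N: "\<And>n. n \<ge> N \<Longrightarrow> norm (A n - 0) < e / (2 * t)"
      using LIMSEQ_D by blast
    show "\<exists>N. \<forall>n\<ge>N. cmod ((LINT x|lborel. F n x * \<psi> x) - (LINT x|lborel. f x * \<psi> x)) < e"
    proof (intro exI allI impI)
      fix n assume "n \<ge> N"
      then have "A n < e / (2 * t)" using N[of n] by simp
      then have "t * A n < e / 2" using t by (simp add: field_simps)
      then show "cmod ((LINT x|lborel. F n x * \<psi> x) - (LINT x|lborel. f x * \<psi> x)) < e"
        using bound[OF t, of n] \<open>B / t < e / 2\<close> by linarith
    qed
  qed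
qed

text \<open>
  Pointwise convergence under one integrable majorant of the squared moduli gives \<open>L\<^sup>2\<close> convergence.
  Both convergence claims, in time and in frequency, are instances.
\<close>

lemma L2_converges_dominated:
  assumes meas: "\<And>n. F n \<in> borel_measurable lborel"
    and lim: "\<And>x. (\<lambda>n. F n x) \<longlonglongrightarrow> f x"
    and w: "integrable lborel w" and bound: "\<And>n x. (cmod (F n x))\<^sup>2 \<le> w x"
  shows "L2_converges F f"
proof -
  have fm: "f \<in> borel_measurable lborel"
    using meas by (rule borel_measurable_LIMSEQ_metric) (rule lim)
  have wm: "w \<in> borel_measurable lborel" using w by simp
  note [measurable] = meas fm wm
  have fb: "(cmod (f x))\<^sup>2 \<le> w x" for x
    by (rule LIMSEQ_le_const2[OF tendsto_power[OF tendsto_norm[OF lim]]]) (use bound in auto)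
  have sq: "square_integrable h" if "h \<in> borel_measurable lborel" "\<And>x. (cmod (h x))\<^sup>2 \<le> w x" for h
    unfolding square_integrable_def
  proof
    note [measurable] = that(1)
    show "integrable lborel (\<lambda>x. (cmod (h x))\<^sup>2)"
      by (rule Bochner_Integration.integrable_bound[OF w]) (use that(2) in \<open>auto intro: order_trans[OF _ abs_ge_self]\<close>)
  qed (use that in auto)
  have "(\<lambda>n. LINT x|lborel. (cmod (F n x - f x))\<^sup>2) \<longlonglongrightarrow> (LINT x|(lborel::real measure). 0)"
  proof (rule integral_dominated_convergence)
    show "integrable lborel (\<lambda>x. 4 * w x)" using w by simp
    show "AE x in lborel. (\<lambda>n. (cmod (F n x - f x))\<^sup>2) \<longlonglongrightarrow> 0"
    proof (rule AE_I2)
      fix x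
      have "(\<lambda>n. (cmod (F n x - f x))\<^sup>2) \<longlonglongrightarrow> (cmod (f x - f x))\<^sup>2"
        by (intro tendsto_intros lim)
      then show "(\<lambda>n. (cmod (F n x - f x))\<^sup>2) \<longlonglongrightarrow> 0" by simp
    qed
    show "AE x in lborel. norm ((cmod (F n x - f x))\<^sup>2) \<le> 4 * w x" for n
    proof (rule AE_I2)
      fix x
      have "(cmod (F n x - f x))\<^sup>2 \<le> 2 * (cmod (F n x))\<^sup>2 + 2 * (cmod (f x))\<^sup>2"
        by (rule norm_diff_square_le)
      also have "\<dots> \<le> 4 * w x" using bound[of n x] fb[of x] by simp
      finally show "norm ((cmod (F n x - f x))\<^sup>2) \<le> 4 * w x" by simp
    qed
  qed measurable
  then show ?thesis
    unfolding L2_converges_def using sq[OF meas bound] sq[OF fm fb] by simp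
qed

section \<open>Uniqueness of the continuous function with a given Fourier transform\<close>

text \<open>
  Both sides are the double integral of \<open>f x * g \<omega> * exp (- \<i> x \<omega>)\<close>, by Fubini.
\<close>

lemma fourier_multiplication_formula:
  assumes f: "integrable lborel f" and g: "integrable lborel g"
  shows "(LINT x|lborel. f x * fourier_L1 g x) = (LINT \<omega>|lborel. fourier_L1 f \<omega> * g \<omega>)"
proof -
  define k where "k x \<omega> = f x * g \<omega> * exp (- \<i> * of_real x * of_real \<omega>)" for x \<omega> :: real
  have [measurable]: "f \<in> borel_measurable borel" "g \<in> borel_measurable borel"
    using f g by auto
  have nk: "cmod (k x \<omega>) = cmod (f x) * cmod (g \<omega>)" for x \<omega>
    by (simp add: k_def norm_mult)
  have "integrable (lborel \<Otimes>\<^sub>M lborel) (case_prod k)"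
  proof (rule lborel_pair.Fubini_integrable)
    show "case_prod k \<in> borel_measurable (lborel \<Otimes>\<^sub>M lborel)"
      unfolding k_def case_prod_beta by measurable
    show "integrable lborel (\<lambda>x. LINT y|lborel. norm (case_prod k (x, y)))"
      using f by (simp add: nk)
    show "AE x in lborel. integrable lborel (\<lambda>y. case_prod k (x, y))"
    proof (rule AE_I2)
      fix x
      have "integrable lborel (\<lambda>y. cmod (f x) * cmod (g y))"
        using g by simp
      then show "integrable lborel (\<lambda>y. case_prod k (x, y))"
        by (rule Bochner_Integration.integrable_bound)
            (auto simp add: nk norm_mult[symmetric] simp del: norm_mult, auto simp: k_def norm_mult)
    qed
  qed
  then have "(LINT \<omega>|lborel. LINT x|lborel. k x \<omega>) = (LINT x|lborel. LINT \<omega>|lborel. k x \<omega>)"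
    by (rule lborel_pair.Fubini_integral)
  moreover have "(LINT \<omega>|lborel. k x \<omega>) = f x * fourier_L1 g x" for x
    unfolding k_def fourier_L1_def by (simp add: mult.assoc)
  moreover have "(LINT x|lborel. k x \<omega>) = fourier_L1 f \<omega> * g \<omega>" for \<omega>
  proof -
    have "k x \<omega> = (f x * exp (- \<i> * of_real \<omega> * of_real x)) * g \<omega>" for x
      by (simp add: k_def mult_ac)
    then show ?thesis unfolding fourier_L1_def by simp
  qed
  ultimately show ?thesis by simp
qed

text \<open>
  The multiplication formula survives the passage to the \<open>L\<^sup>2\<close> limit. It expresses the pairings of
  \<open>E\<close> with transforms of test functions through \<open>g\<close> alone, which is how uniqueness is reached
  without Plancherel's theorem.
\<close>

lemma is_fourier_L2_pairing:
  assumes E: "is_fourier_L2 E g"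
    and \<phi>: "integrable lborel \<phi>" "square_integrable \<phi>" "square_integrable (fourier_L1 \<phi>)"
  shows "(LINT x|lborel. E x * fourier_L1 \<phi> x) = (LINT \<omega>|lborel. g \<omega> * \<phi> \<omega>)"
proof -
  from E obtain F where F: "\<And>n. integrable lborel (F n)" "L2_converges F E"
    "L2_converges (\<lambda>n. fourier_L1 (F n)) g"
    unfolding is_fourier_L2_def by blast
  have "(\<lambda>n. LINT x|lborel. F n x * fourier_L1 \<phi> x) \<longlonglongrightarrow> (LINT x|lborel. E x * fourier_L1 \<phi> x)"
    using F(2) \<phi>(3) by (rule L2_converges_pairing)
  moreover have "(\<lambda>n. LINT x|lborel. F n x * fourier_L1 \<phi> x) \<longlonglongrightarrow> (LINT \<omega>|lborel. g \<omega> * \<phi> \<omega>)"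
    using L2_converges_pairing[OF F(3) \<phi>(2)]
    by (simp add: fourier_multiplication_formula[OF F(1) \<phi>(1)])
  ultimately show ?thesis by (rule LIMSEQ_unique)
qed

lemma integrable_gaussian:
  assumes "n > 0"
  shows "integrable lborel (\<lambda>x::real. exp (- (n * (x - c))\<^sup>2 / 2))"
proof -
  have "integrable lborel (\<lambda>x. sqrt (2 * pi) * std_normal_density (- n * c + n * x))"
    using assms by (intro integrable_mult_right lborel_integrable_real_affine) auto
  then show ?thesis by (simp add: std_normal_density_def algebra_simps)
qed

lemma square_integrable_gaussian:
  assumes "n > 0"
  shows "square_integrable (\<lambda>x. of_real (exp (- (n * (x - c))\<^sup>2 / 2)))"
proof -
  have "(\<lambda>x. (exp (- (n * (x - c))\<^sup>2 / 2))\<^sup>2) = (\<lambda>x. exp (- ((sqrt 2 * n) * (x - c))\<^sup>2 / 2))"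
    by (auto simp flip: exp_double simp: power_mult_distrib)
  with integrable_gaussian[of "sqrt 2 * n" c] assms
  show ?thesis by (simp add: square_integrable_def)
qed

text \<open>
  The characteristic function of the standard normal distribution, rescaled and translated: as test
  functions, these have as transforms Gaussian bumps of width \<open>1 / n\<close> around any prescribed point.
\<close>

lemma fourier_L1_modulated_gaussian:
  assumes n: "n > 0"
  shows "fourier_L1 (\<lambda>\<omega>. of_real (std_normal_density (\<omega> / n) / n) * exp (\<i> * of_real (c * \<omega>)))
       = (\<lambda>x. of_real (exp (- (n * (x - c))\<^sup>2 / 2)))"
proof
  fix x
  have ch: "(LINT u|lborel. of_real (std_normal_density u) * exp (\<i> * of_real (t * u)))
      = of_real (exp (- t\<^sup>2 / 2))" for t
    using fun_cong[OF char_std_normal_distribution, of t]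
    by (simp add: char_def integral_density scaleR_conv_of_real)
  have "fourier_L1 (\<lambda>\<omega>. of_real (std_normal_density (\<omega> / n) / n) * exp (\<i> * of_real (c * \<omega>))) x
     = (LINT \<omega>|lborel. of_real (std_normal_density (\<omega> / n) / n) * exp (\<i> * of_real ((c - x) * \<omega>)))"
    unfolding fourier_L1_def 
    by (intro Bochner_Integration.integral_cong refl) (simp add: mult.assoc exp_add[symmetric] algebra_simps)
  also have "\<dots> = (LINT u|lborel. of_real (std_normal_density u) * exp (\<i> * of_real ((n * (c - x)) * u)))"
    using n by (subst lborel_integral_real_affine[where c=n and t=0])
        (auto simp: scaleR_conv_of_real mult_ac)
  also have "\<dots> = of_real (exp (- (n * (c - x))\<^sup>2 / 2))" by (rule ch)
  also have "(n * (c - x))\<^sup>2 = (n * (x - c))\<^sup>2"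
    by (simp add: power_mult_distrib power2_commute)
  finally show "fourier_L1 (\<lambda>\<omega>. of_real (std_normal_density (\<omega> / n) / n) * exp (\<i> * of_real (c * \<omega>))) x
     = of_real (exp (- (n * (x - c))\<^sup>2 / 2))" .
qed

text \<open>
  A continuous square integrable function is recovered pointwise from its pairings with narrow
  Gaussians. Since it need not be bounded, the integral is split at distance \<open>1\<close> from \<open>c\<close>.
\<close>

lemma gaussian_approximate_identity:
  assumes cont: "continuous_on UNIV E" and E: "square_integrable E"
  shows "(\<lambda>n. of_nat (Suc n)
      * (LINT x|lborel. E x * of_real (exp (- (real (Suc n) * (x - c))\<^sup>2 / 2))))
            \<longlonglongrightarrow> of_real (sqrt (2 * pi)) * E c"
proof -
  define G where "G n x = complex_of_real (exp (- (real (Suc n) * (x - c))\<^sup>2 / 2))" for n x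
  define I where "I = {c-1..c+1}"
  have [measurable]: "E \<in> borel_measurable borel" using E by (simp add: square_integrable_def)
  have Gm[measurable]: "G n \<in> borel_measurable borel" for n unfolding G_def by measurable
  have [measurable]: "I \<in> sets borel" by (simp add: I_def)
  have EG: "integrable lborel (\<lambda>x. E x * G n x)" for n
    unfolding G_def by (intro square_integrable_mult_integrable E square_integrable_gaussian) simp
  \<comment> \<open>Near \<open>c\<close> the function is bounded, so after rescaling a multiple of the standard Gaussian
    dominates.\<close>
  have near: "(\<lambda>n. of_nat (Suc n) * (LINT x|lborel. indicator I x * (E x * G n x)))
      \<longlonglongrightarrow> of_real (sqrt (2 * pi)) * E c"
  proof -
    define h where "h n u
        = indicator I (c + u / real (Suc n)) * E (c + u / real (Suc n)) * of_real (exp (- u\<^sup>2 / 2))" for n u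
    have "compact (E ` I)" unfolding I_def
      by (intro compact_continuous_image continuous_on_subset[OF cont]) auto
    then have "bounded (E ` I)" by (rule compact_imp_bounded)
    then obtain M where "\<forall>y\<in>E ` I. cmod y \<le> M" unfolding bounded_iff by blast
    then have M: "\<And>x. x \<in> I \<Longrightarrow> cmod (E x) \<le> M" by simp
    have "cmod (E c) \<le> M" by (rule M) (simp add: I_def)
    then have M0: "M \<ge> 0" using norm_ge_zero[of "E c"] by linarith
    have *: "of_nat (Suc n) * (LINT x|lborel. indicator I x * (E x * G n x))
        = (LINT u|lborel. h n u)" for n
    proof -
      have "(LINT u|lborel. h n u) = of_nat (Suc n)
          * (LINT x|lborel. h n (- real (Suc n) * c + real (Suc n) * x))"
        by (subst lborel_integral_real_affine[where c="real (Suc n)" and t="- real (Suc n) * c"])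
            (auto simp: scaleR_conv_of_real)
      also have "(\<lambda>x. h n (- real (Suc n) * c + real (Suc n) * x))
          = (\<lambda>x. indicator I x * (E x * G n x))"
      proof
        fix x
        have "c + (- real (Suc n) * c + real (Suc n) * x) / real (Suc n) = x"
            by (simp add: field_simps del: of_nat_Suc)
        moreover have "- real (Suc n) * c + real (Suc n) * x = real (Suc n) * (x - c)"
            by (simp add: algebra_simps)
        ultimately show "h n (- real (Suc n) * c + real (Suc n) * x)
            = indicator I x * (E x * G n x)"
          unfolding h_def G_def by (metis mult.assoc)
      qed
      finally show ?thesis by simp
    qed
    have gi: "integrable lborel (\<lambda>u::real. exp (- u\<^sup>2 / 2))"
        using integrable_gaussian[of 1 0] by simp
    have gI: "(LINT u|lborel. exp (- u\<^sup>2 / 2)) = sqrt (2 * pi)"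
      using integral_normal_density[of 1 0] unfolding std_normal_density_def by (simp add: field_simps)
    have "(\<lambda>n. LINT u|lborel. h n u) \<longlonglongrightarrow> (LINT u|lborel. E c * of_real (exp (- u\<^sup>2 / 2)))"
    proof (rule integral_dominated_convergence)
      show "integrable lborel (\<lambda>u. M * exp (- u\<^sup>2 / 2))" using gi by simp
      show "AE u in lborel. (\<lambda>n. h n u) \<longlonglongrightarrow> E c * of_real (exp (- u\<^sup>2 / 2))"
      proof (rule AE_I2)
        fix u :: real
        have lim: "(\<lambda>n. c + u / real (Suc n)) \<longlonglongrightarrow> c"
          using tendsto_add[OF tendsto_const[of c] lim_const_over_n[of u, THEN LIMSEQ_Suc]] by simp
        have "isCont E c" using cont by (simp add: continuous_on_eq_continuous_at)
        then have "(\<lambda>n. E (c + u / real (Suc n))) \<longlonglongrightarrow> E c"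
            using lim by (rule isCont_tendsto_compose)
        then have "(\<lambda>n. E (c + u / real (Suc n)) * of_real (exp (- u\<^sup>2 / 2)))
            \<longlonglongrightarrow> E c * of_real (exp (- u\<^sup>2 / 2))"
          by (intro tendsto_intros)
        moreover have "eventually (\<lambda>n. c + u / real (Suc n) \<in> {c-1<..<c+1}) sequentially"
          by (rule topological_tendstoD[OF lim]) auto
        then have "eventually (\<lambda>n. E (c + u / real (Suc n)) * of_real (exp (- u\<^sup>2 / 2))
            = h n u) sequentially"
          by eventually_elim (auto simp: h_def I_def)
        ultimately show "(\<lambda>n. h n u) \<longlonglongrightarrow> E c * of_real (exp (- u\<^sup>2 / 2))"
          by (rule Lim_transform_eventually)
      qed
      show "AE u in lborel. norm (h n u) \<le> M * exp (- u\<^sup>2 / 2)" for n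
        using M M0 by (auto simp: h_def norm_mult indicator_def intro!: AE_I2)
      show "h n \<in> borel_measurable lborel" for n unfolding h_def by measurable
    qed simp
    moreover have "(LINT u|lborel. E c * of_real (exp (- u\<^sup>2 / 2)))
        = of_real (sqrt (2 * pi)) * E c"
      using gI by (simp only: integral_mult_right_zero integral_complex_of_real mult.commute)
    ultimately show ?thesis by (simp only: *)
  qed
  \<comment> \<open>Away from \<open>c\<close> only square integrability is known, but there the \<open>n\<close>-th Gaussian is at most
    a rapidly vanishing multiple of the \<open>0\<close>-th one, against which \<open>E\<close> is integrable.\<close>
  have far: "(\<lambda>n. of_nat (Suc n) * (LINT x|lborel. indicator (-I) x * (E x * G n x))) \<longlonglongrightarrow> 0"
  proof -
    define K where "K = (LINT x|lborel. cmod (E x * G 0 x))"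
    have est: "cmod (of_nat (Suc n) * (LINT x|lborel. indicator (-I) x * (E x * G n x)))
        \<le> real (Suc n) * exp ((1 - (real (Suc n))\<^sup>2) / 2) * K" for n
    proof -
      have "cmod (LINT x|lborel. indicator (-I) x * (E x * G n x))
          \<le> (LINT x|lborel. exp ((1 - (real (Suc n))\<^sup>2) / 2) * cmod (E x * G 0 x))"
      proof (rule order_trans[OF integral_norm_bound integral_mono])
        show "integrable lborel (\<lambda>x. exp ((1 - (real (Suc n))\<^sup>2) / 2) * cmod (E x * G 0 x))"
          using EG[of 0] by auto
        show "integrable lborel (\<lambda>x. cmod (indicator (-I) x * (E x * G n x)))"
          by (rule Bochner_Integration.integrable_bound[OF EG[of n]])
              (auto simp: norm_mult indicator_def)
        fix x
        show "cmod (indicator (-I) x * (E x * G n x))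
            \<le> exp ((1 - (real (Suc n))\<^sup>2) / 2) * cmod (E x * G 0 x)"
        proof (cases "x \<in> I")
          case False
          then have "\<bar>x - c\<bar> \<ge> 1" by (auto simp: I_def abs_if)
          then have "1 \<le> (x - c)\<^sup>2" using abs_le_square_iff[of 1 "x - c"] by simp
          moreover have "1 - (real (Suc n))\<^sup>2 \<le> 0"
            using one_le_power[of "real (Suc n)" 2] by simp
          ultimately have "(1 - (real (Suc n))\<^sup>2) * (x - c)\<^sup>2 \<le> (1 - (real (Suc n))\<^sup>2) * 1"
            by (rule mult_left_mono_neg)
          then have "- (real (Suc n) * (x - c))\<^sup>2 / 2
              \<le> (1 - (real (Suc n))\<^sup>2) / 2 + - (real (Suc 0) * (x - c))\<^sup>2 / 2"
            by (simp only: power_mult_distrib) (simp add: algebra_simps)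
          then have "exp (- (real (Suc n) * (x - c))\<^sup>2 / 2)
              \<le> exp ((1 - (real (Suc n))\<^sup>2) / 2) * exp (- (real (Suc 0) * (x - c))\<^sup>2 / 2)"
            by (simp only: exp_add[symmetric] exp_le_cancel_iff)
          then have "cmod (G n x) \<le> exp ((1 - (real (Suc n))\<^sup>2) / 2) * cmod (G 0 x)"
            by (simp only: G_def norm_of_real abs_exp_cancel)
          then have "cmod (E x) * cmod (G n x)
              \<le> cmod (E x) * (exp ((1 - (real (Suc n))\<^sup>2) / 2) * cmod (G 0 x))"
            by (intro mult_left_mono) auto
          then show ?thesis using False by (simp add: norm_mult mult_ac)
        qed auto
      qed
      then have "cmod (LINT x|lborel. indicator (-I) x * (E x * G n x))
          \<le> exp ((1 - (real (Suc n))\<^sup>2) / 2) * K"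
        by (simp add: K_def)
      then have "real (Suc n) * cmod (LINT x|lborel. indicator (-I) x * (E x * G n x))
          \<le> real (Suc n) * (exp ((1 - (real (Suc n))\<^sup>2) / 2) * K)"
        by (intro mult_left_mono) auto
      then show ?thesis by (simp only: norm_mult norm_of_nat mult.assoc)
    qed
    have "(\<lambda>n. real (Suc n) * exp ((1 - (real (Suc n))\<^sup>2) / 2)) \<longlonglongrightarrow> 0"
      by real_asymp
    then have "(\<lambda>n. real (Suc n) * exp ((1 - (real (Suc n))\<^sup>2) / 2) * K) \<longlonglongrightarrow> 0"
      by (rule tendsto_mult_left_zero)
    then show ?thesis
      by (rule Lim_null_comparison[OF always_eventually, rotated]) (use est in auto)
  qed
  have "(LINT x|lborel. E x * G n x) = (LINT x|lborel. indicator I x * (E x * G n x))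
      + (LINT x|lborel. indicator (-I) x * (E x * G n x))" for n
  proof -
    have "integrable lborel (\<lambda>x. indicator A x * (E x * G n x))" if "A \<in> sets borel" for A
      by (rule Bochner_Integration.integrable_bound[OF EG[of n]]) (use that in \<open>auto simp: norm_mult indicator_def\<close>)
    then have "(LINT x|lborel. indicator I x * (E x * G n x))
        + (LINT x|lborel. indicator (-I) x * (E x * G n x)) = 
      (LINT x|lborel. indicator I x * (E x * G n x) + indicator (-I) x * (E x * G n x))"
      by (intro Bochner_Integration.integral_add[symmetric]) auto
    also have "\<dots> = (LINT x|lborel. E x * G n x)"
      by (intro Bochner_Integration.integral_cong) (auto simp: indicator_def)
    finally show ?thesis by simp
  qed
  with tendsto_add[OF near far] show ?thesis
    unfolding G_def[symmetric] by (simp add: distrib_left del: of_nat_Suc)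
qed

text \<open>
  The pairings of \<open>E\<close> with all Gaussian bumps are determined by the transform, and they determine
  a continuous \<open>E\<close> at every point.
\<close>

lemma is_fourier_L2_continuous_unique:
  assumes "is_fourier_L2 E1 g" "continuous_on UNIV E1"
    and "is_fourier_L2 E2 g" "continuous_on UNIV E2"
  shows "E1 = E2"
proof
  fix c :: real
  \<comment> \<open>The normalised Gaussian of width \<open>n + 1\<close>, modulated so that its transform is a bump at \<open>c\<close>.\<close>
  define \<phi> where "\<phi> n = (\<lambda>\<omega>. complex_of_real (std_normal_density (\<omega> / real (Suc n)) / real (Suc n)) * exp (\<i> * of_real (c * \<omega>)))" for n
  have *: "(\<lambda>n. of_nat (Suc n) * (LINT \<omega>|lborel. g \<omega> * \<phi> n \<omega>)) \<longlonglongrightarrow> of_real (sqrt (2 * pi)) * E c"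
    if "is_fourier_L2 E g" "continuous_on UNIV E" for E
  proof -
    have E: "square_integrable E" using that(1) by (auto simp: is_fourier_L2_def L2_converges_def)
    have "(LINT x|lborel. E x * of_real (exp (- (real (Suc n) * (x - c))\<^sup>2 / 2)))
        = (LINT \<omega>|lborel. g \<omega> * \<phi> n \<omega>)" for n
    proof -
      define C where "C = 1 / sqrt (2 * pi) / real (Suc n)"
      have C: "cmod (\<phi> n \<omega>) = C * exp (- (1 / real (Suc n) * (\<omega> - 0))\<^sup>2 / 2)" for \<omega>
        unfolding \<phi>_def C_def std_normal_density_def by (simp add: norm_mult norm_divide del: of_nat_Suc)
      have [measurable]: "\<phi> n \<in> borel_measurable borel" unfolding \<phi>_def by measurable
      have i1: "integrable lborel (\<phi> n)"
        by (rule Bochner_Integration.integrable_bound[OF integrable_mult_right[OF integrable_gaussian[of "1 / real (Suc n)" 0], of C]])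
           (auto simp only: C, auto simp: C_def)
      have i2: "square_integrable (\<phi> n)"
        using square_integrable_gaussian[of "1 / real (Suc n)" 0]
        unfolding square_integrable_def C power_mult_distrib by simp
      have ft: "fourier_L1 (\<phi> n) = (\<lambda>x. of_real (exp (- (real (Suc n) * (x - c))\<^sup>2 / 2)))"
        unfolding \<phi>_def by (rule fourier_L1_modulated_gaussian) simp
      show ?thesis
        using is_fourier_L2_pairing[OF that(1) i1 i2] square_integrable_gaussian[of "real (Suc n)" c]
        unfolding ft by simp
    qed
    with gaussian_approximate_identity[OF that(2) E, of c] show ?thesis by simp
  qed
  have "of_real (sqrt (2 * pi)) * E1 c = of_real (sqrt (2 * pi)) * E2 c"
    using *[OF assms(1,2)] *[OF assms(3,4)] by (rule LIMSEQ_unique)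
  then show "E1 c = E2 c" by simp
qed

section \<open>Laplace transform of the truncated power\<close>

lemma trunc_power_eq_powr: "x > 0 \<Longrightarrow> trunc_power x w = of_real x powr w"
  by (simp add: trunc_power_def powr_def Ln_of_real)

lemma norm_trunc_power: "cmod (trunc_power x w) = (if x > 0 then x powr Re w else 0)"
  by (simp add: trunc_power_def powr_def)

lemma borel_measurable_trunc_power [measurable]: "(\<lambda>x. trunc_power x w) \<in> borel_measurable borel"
  unfolding trunc_power_def by measurable

lemma trunc_power_scale: "r > 0 \<Longrightarrow> trunc_power (r * x) w = of_real r powr w * trunc_power x w"
  by (auto simp: trunc_power_def zero_less_mult_iff powr_def Ln_of_real ln_mult algebra_simps exp_add)

lemma trunc_power_add_nat: "trunc_power x (w + of_nat n) = trunc_power x w * of_real x ^ n"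
  by (auto simp: trunc_power_def distrib_right exp_add exp_of_nat_mult exp_of_real)

text \<open>
  Euler's integral for \<open>Gamma\<close>, after the substitution of \<open>r * t\<close> for \<open>t\<close>.
\<close>

lemma laplace_trunc_power_real:
  assumes z: "Re z > 0" and r: "r > 0"
  shows "has_bochner_integral lborel (\<lambda>t. trunc_power t (z - 1) * exp (- of_real r * of_real t))
           (Gamma z * of_real r powr (- z))"
proof -
  let ?f = "\<lambda>t::real. trunc_power t (z - 1) * exp (- of_real t)"
  have eq: "?f t = indicator {0<..} t *\<^sub>R (complex_of_real t powr (z - 1) / of_real (exp t))"
      for t
    by (cases "t > 0")
       (auto simp: trunc_power_eq_powr indicator_def exp_minus divide_inverse exp_of_real,
        auto simp: trunc_power_def)
  have m: "?f \<in> borel_measurable lborel" by measurable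
  have int: "integrable lebesgue ?f"
    using absolutely_integrable_Gamma_integral'[OF z] unfolding set_integrable_def eq .
  then have intb: "integrable lborel ?f" using m by (simp add: integrable_completion)
  have "(?f has_integral integral\<^sup>L lborel ?f) UNIV"
    by (rule has_integral_integral_lborel[OF intb])
  moreover have "(?f has_integral Gamma z) UNIV"
  proof -
    have "((\<lambda>t. if t \<in> {0<..} then complex_of_real t powr (z - 1) / of_real (exp t) else 0) has_integral Gamma z) UNIV"
      using Gamma_integral_complex'[OF z] by (simp only: has_integral_restrict_UNIV)
    then show ?thesis by (rule has_integral_eq[rotated]) (auto simp: eq indicator_def)
  qed
  ultimately have "integral\<^sup>L lborel ?f = Gamma z" by (rule has_integral_unique)
  with intb have hb: "has_bochner_integral lborel ?f (Gamma z)"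
      by (simp add: has_bochner_integral_iff)
  have "has_bochner_integral lborel (\<lambda>t. ?f (0 + r * t)) (Gamma z /\<^sub>R \<bar>r\<bar>)"
    using hb r by (subst (asm) lborel_has_bochner_integral_real_affine_iff[of r _ _ 0]) auto
  then have "has_bochner_integral lborel (\<lambda>t. (1 / of_real r powr (z - 1)) * ?f (r * t)) ((1 / of_real r powr (z - 1)) * (Gamma z /\<^sub>R \<bar>r\<bar>))"
    by (intro has_bochner_integral_mult_right) auto
  moreover have "(\<lambda>t. (1 / of_real r powr (z - 1)) * ?f (r * t))
      = (\<lambda>t. trunc_power t (z - 1) * exp (- of_real r * of_real t))"
    using r by (auto simp: trunc_power_scale)
  moreover have "(1 / of_real r powr (z - 1)) * (Gamma z /\<^sub>R \<bar>r\<bar>)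
      = Gamma z * of_real r powr (- z)"
    using r by (simp add: powr_diff powr_minus scaleR_conv_of_real field_simps)
  ultimately show ?thesis by simp
qed

text \<open>
  For complex rates the substitution is not available. Instead the factor \<open>exp (- w * t)\<close> is expanded
  into its power series around a real rate \<open>r\<close>. Integrated term by term, it becomes the binomial
  series of \<open>(1 + w / r) powr (- z)\<close>; the condition \<open>\<bar>w\<bar> < r\<close> makes both the dominating function
  \<open>t powr (Re z - 1) * exp (- (r - \<bar>w\<bar>) * t)\<close> integrable and the binomial series convergent.
\<close>

lemma laplace_trunc_power_near_real:
  assumes z: "Re z > 0" and r: "r > 0" and w: "cmod w < r"
  shows "(LINT t|lborel. trunc_power t (z - 1) * exp (- (of_real r + w) * of_real t))
       = Gamma z * (of_real r + w) powr (- z)"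
proof -
  let ?k = "\<lambda>t. trunc_power t (z - 1) * exp (- of_real r * of_real t)"
  define F where "F N t = (\<Sum>n<N. ?k t * ((- w * of_real t) ^ n /\<^sub>R fact n))" for N t
  \<comment> \<open>Multiplication by \<open>t ^ n\<close> raises the exponent from \<open>z\<close> to \<open>z + n\<close>, and
    \<open>Gamma (z + n)\<close> contributes the rising factorial that makes up the binomial coefficient.\<close>
  have mom: "has_bochner_integral lborel (\<lambda>t. ?k t * ((- w * of_real t) ^ n /\<^sub>R fact n))
       (Gamma z * of_real r powr (- z) * ((- z gchoose n) * (w / of_real r) ^ n))" for n
  proof -
    have "Re (z + of_nat n) > 0" using z by simp
    from has_bochner_integral_mult_right[OF laplace_trunc_power_real[OF this r],
        of "(- w) ^ n / fact n"]
    have "has_bochner_integral lborel (\<lambda>t. (- w) ^ n / fact n * (trunc_power t (z + of_nat n - 1) * exp (- of_real r * of_real t)))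
       ((- w) ^ n / fact n * (Gamma (z + of_nat n) * of_real r powr (- (z + of_nat n))))" by simp
    moreover have "trunc_power t (z + of_nat n - 1) = trunc_power t (z - 1) * of_real t ^ n" for t
      using trunc_power_add_nat[of t "z - 1" n] by (simp add: algebra_simps)
    then have "(\<lambda>t. (- w) ^ n / fact n * (trunc_power t (z + of_nat n - 1) * exp (- of_real r * of_real t)))
        = (\<lambda>t. ?k t * ((- w * of_real t) ^ n /\<^sub>R fact n))"
      by (auto simp: power_mult_distrib power_minus[of w] power_minus[of "w * _"] scaleR_conv_of_real field_simps)
    moreover have "(- w) ^ n / fact n * (Gamma (z + of_nat n) * of_real r powr (- (z + of_nat n)))
       = Gamma z * of_real r powr (- z) * ((- z gchoose n) * (w / of_real r) ^ n)"
    proof -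
      have "z \<notin> \<int>\<^sub>\<le>\<^sub>0" using z by (auto elim!: nonpos_Ints_cases)
      then have "Gamma (z + of_nat n) = pochhammer z n * Gamma z"
        using pochhammer_Gamma[of z n] by (simp add: Gamma_eq_zero_iff)
      moreover have "of_real r powr (- (z + of_nat n)) = of_real r powr (- z) / of_real r ^ n"
        using r by (simp add: powr_diff powr_minus powr_add powr_nat' field_simps)
      ultimately show ?thesis
        by (simp add: gbinomial_pochhammer power_divide power_minus[of w] field_simps)
    qed
    ultimately show ?thesis by simp
  qed
  have lim: "(\<lambda>N. LINT t|lborel. F N t) \<longlonglongrightarrow> (LINT t|lborel. ?k t * exp (- w * of_real t))"
  proof (rule integral_dominated_convergence)
    have "integrable lborel (\<lambda>t. trunc_power t (of_real (Re z) - 1) * exp (- of_real (r - cmod w) * of_real t))"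
      using laplace_trunc_power_real[of "of_real (Re z)" "r - cmod w"] z w by
          (auto simp: has_bochner_integral_iff)
    then show "integrable lborel (\<lambda>t. cmod (trunc_power t (of_real (Re z) - 1) * exp (- of_real (r - cmod w) * of_real t)))"
      by (rule integrable_norm)
    show "AE t in lborel. (\<lambda>N. F N t) \<longlonglongrightarrow> ?k t * exp (- w * of_real t)"
      unfolding F_def sums_def[symmetric] by (intro AE_I2 sums_mult exp_converges)
    show "AE t in lborel. norm (F N t)
        \<le> cmod (trunc_power t (of_real (Re z) - 1) * exp (- of_real (r - cmod w) * of_real t))"
            for N
    proof (rule AE_I2)
      fix t :: real
      show "norm (F N t) \<le> cmod (trunc_power t (of_real (Re z) - 1) * exp (- of_real (r - cmod w) * of_real t))"
      proof (cases "t > 0")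
        case True
        have "cmod (\<Sum>n<N. (- w * of_real t) ^ n /\<^sub>R fact n) \<le> (\<Sum>n<N. (cmod w * t) ^ n /\<^sub>R fact n)"
          by (rule sum_norm_le) (use True in \<open>simp add: norm_mult norm_power norm_divide power_mult_distrib\<close>)
        also have "\<dots> \<le> exp (cmod w * t)"
          using exp_converges[of "cmod w * t"] True
          by (metis (no_types, lifting) finite_lessThan less_imp_le norm_ge_zero mult_nonneg_nonneg scaleR_nonneg_nonneg inverse_nonnegative_iff_nonnegative fact_ge_zero zero_le_power sum_le_suminf sums_iff)
        finally have "cmod (?k t) * cmod (\<Sum>n<N. (- w * of_real t) ^ n /\<^sub>R fact n)
            \<le> cmod (?k t) * exp (cmod w * t)"
          by (intro mult_left_mono) auto
        moreover have "F N t = ?k t * (\<Sum>n<N. (- w * of_real t) ^ n /\<^sub>R fact n)"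
          unfolding F_def by (rule sum_distrib_left[symmetric])
        moreover have "cmod (?k t) * exp (cmod w * t)
            = cmod (trunc_power t (of_real (Re z) - 1) * exp (- of_real (r - cmod w) * of_real t))"
          using True by (simp add: norm_mult norm_trunc_power mult_exp_exp algebra_simps)
        ultimately show ?thesis by (simp only: norm_mult)
      qed (simp add: F_def trunc_power_def)
    qed
    show "F N \<in> borel_measurable lborel" for N unfolding F_def by measurable
  qed measurable
  have partial: "(LINT t|lborel. F N t)
      = (\<Sum>n<N. Gamma z * of_real r powr (- z) * ((- z gchoose n) * (w / of_real r) ^ n))" for N
    unfolding F_def by (rule has_bochner_integral_integral_eq, rule has_bochner_integral_sum) (rule mom)
  have series: "(\<lambda>N. (\<Sum>n<N. Gamma z * of_real r powr (- z) * ((- z gchoose n) * (w / of_real r) ^ n)))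
     \<longlonglongrightarrow> Gamma z * of_real r powr (- z) * (1 + w / of_real r) powr (- z)"
    unfolding sums_def[symmetric] using w r
    by (intro sums_mult gen_binomial_complex) (simp add: norm_divide)
  have "(LINT t|lborel. ?k t * exp (- w * of_real t))
      = Gamma z * of_real r powr (- z) * (1 + w / of_real r) powr (- z)"
    using lim unfolding partial by (rule LIMSEQ_unique) (rule series)
  also have "\<dots> = Gamma z * (of_real r * (1 + w / of_real r)) powr (- z)"
    using r by (subst powr_times_real_left) auto
  also have "of_real r * (1 + w / of_real r) = of_real r + w" using r by (simp add: field_simps)
  also have "(\<lambda>t::real. ?k t * exp (- w * of_real t))
      = (\<lambda>t. trunc_power t (z - 1) * exp (- (of_real r + w) * of_real t))"
    by (simp add: mult.assoc mult_exp_exp algebra_simps)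
  finally show ?thesis .
qed

text \<open>
  Every point of the right half-plane lies in a disc that is centred at some \<open>r > 0\<close> and touches the
  imaginary axis only at the origin, so the local formula covers all of it.
\<close>

lemma laplace_trunc_power:
  assumes z: "Re z > 0" and s: "Re s > 0"
  shows "(LINT t|lborel. trunc_power t (z - 1) * exp (- s * of_real t)) = Gamma z * s powr (- z)"
proof -
  \<comment> \<open>This is the radius for which \<open>2 r Re s = 2 \<bar>s\<bar>\<^sup>2\<close>, so that \<open>\<bar>s - r\<bar>\<^sup>2 = r\<^sup>2 - \<bar>s\<bar>\<^sup>2\<close>.\<close>
  define r where "r = (cmod s)\<^sup>2 / Re s"
  have r: "r > 0" using s by (auto simp: r_def intro!: divide_pos_pos)
  have "(cmod (s - of_real r))\<^sup>2 = (cmod s)\<^sup>2 - 2 * r * Re s + r\<^sup>2"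
    by (simp add: cmod_power2 power2_diff algebra_simps)
  also have "r * Re s = (cmod s)\<^sup>2" using s by (simp add: r_def)
  then have "(cmod s)\<^sup>2 - 2 * r * Re s + r\<^sup>2 = r\<^sup>2 - (cmod s)\<^sup>2" by simp
  also have "\<dots> < r\<^sup>2" using s by auto
  finally have "cmod (s - of_real r) < r" using r power_less_imp_less_base[of _ 2 r] by auto
  from laplace_trunc_power_near_real[OF z r this] show ?thesis by simp
qed

section \<open>Series of translates of a causal function\<close>

text \<open>
  A function supported on the positive half-line makes the series of its translates finite at every
  point, so pointwise convergence is trivial; summability of the coefficients provides the
  integrable majorant.
\<close>

lemma L2_converges_shift_series:
  fixes c :: "nat \<Rightarrow> complex"
  assumes c: "summable (\<lambda>l. cmod (c l))"
    and g: "square_integrable g" and g0: "\<And>x. x \<le> 0 \<Longrightarrow> g x = 0"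
  shows "L2_converges (\<lambda>N x. \<Sum>l<N. c l * g (x - real l)) (\<lambda>x. \<Sum>l. c l * g (x - real l))"
proof -
  define C where "C = (\<Sum>l. cmod (c l))"
  define q where "q l x = cmod (c l) * (cmod (g (x - real l)))\<^sup>2" for l x
  have [measurable]: "g \<in> borel_measurable borel" using g by (simp add: square_integrable_def)
  have zero: "g (x - real l) = 0" if "l \<notin> {..<nat \<lceil>x\<rceil>}" for x l
    using that by (intro g0) (simp, linarith)
  have qs: "summable (\<lambda>l. q l x)" for x
    by (rule summable_finite[of "{..<nat \<lceil>x\<rceil>}"]) (auto simp: q_def zero)
  have q0: "q l x \<ge> 0" for l x by (simp add: q_def)
  have gsq: "integrable lborel (\<lambda>x. (cmod (g (x - real l)))\<^sup>2)"
    and gsqI: "(LINT x|lborel. (cmod (g (x - real l)))\<^sup>2) = (LINT x|lborel. (cmod (g x))\<^sup>2)" for l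
  proof -
    have "integrable lborel (\<lambda>x. (cmod (g x))\<^sup>2)" using g by (simp add: square_integrable_def)
    from lborel_integrable_real_affine[OF this, of 1 "- real l"]
    show "integrable lborel (\<lambda>x. (cmod (g (x - real l)))\<^sup>2)" by simp
    show "(LINT x|lborel. (cmod (g (x - real l)))\<^sup>2) = (LINT x|lborel. (cmod (g x))\<^sup>2)"
      using lborel_integral_real_affine[of 1 "\<lambda>x. (cmod (g x))\<^sup>2" "- real l"] by simp
  qed
  show ?thesis
  proof (rule L2_converges_dominated)
    have "integrable lborel (\<lambda>x. \<Sum>l. q l x)"
    proof (rule integrable_suminf)
      show "integrable lborel (q l)" for l unfolding q_def using gsq by simp
      show "AE x in lborel. summable (\<lambda>l. norm (q l x))" using qs q0 by simp
      show "summable (\<lambda>l. LINT x|lborel. norm (q l x))"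
        using q0 by (simp add: q_def gsqI summable_mult2[OF c])
    qed
    then show "integrable lborel (\<lambda>x. C * (\<Sum>l. q l x))" by simp
    fix n x
    \<comment> \<open>Splitting each weight as a product of two square roots lets Cauchy--Schwarz give
      \<open>\<bar>\<Sum> c g\<bar>\<^sup>2 \<le> (\<Sum> \<bar>c\<bar>) (\<Sum> \<bar>c\<bar> \<bar>g\<bar>\<^sup>2)\<close>, which is linear in \<open>\<bar>g\<bar>\<^sup>2\<close>.\<close>
    have "cmod (\<Sum>l<n. c l * g (x - real l))
        \<le> (\<Sum>l<n. sqrt (cmod (c l)) * (sqrt (cmod (c l)) * cmod (g (x - real l))))"
      by (rule sum_norm_le) (simp add: norm_mult flip: mult.assoc)
    then have "(cmod (\<Sum>l<n. c l * g (x - real l)))\<^sup>2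
        \<le> (\<Sum>l<n. sqrt (cmod (c l)) * (sqrt (cmod (c l)) * cmod (g (x - real l))))\<^sup>2"
      by (intro power_mono) auto
    also have "\<dots> \<le> (\<Sum>l<n. (sqrt (cmod (c l)))\<^sup>2) * (\<Sum>l<n. (sqrt (cmod (c l)) * cmod (g (x - real l)))\<^sup>2)"
      by (rule Cauchy_Schwarz_ineq_sum)
    also have "\<dots> = (\<Sum>l<n. cmod (c l)) * (\<Sum>l<n. q l x)"
      by (simp add: q_def power_mult_distrib)
    also have "\<dots> \<le> C * (\<Sum>l. q l x)"
      unfolding C_def by (intro mult_mono sum_le_suminf c qs sum_nonneg suminf_nonneg q0) auto
    finally show "(cmod (\<Sum>l<n. c l * g (x - real l)))\<^sup>2 \<le> C * (\<Sum>l. q l x)" .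
  next
    fix x
    show "(\<lambda>n. \<Sum>l<n. c l * g (x - real l)) \<longlonglongrightarrow> (\<Sum>l. c l * g (x - real l))"
      by (intro summable_LIMSEQ summable_finite[of "{..<nat \<lceil>x\<rceil>}"]) (auto simp: zero)
  qed measurable
qed

text \<open>
  To the left of \<open>n\<close> only the first \<open>n\<close> translates are nonzero.
\<close>

lemma continuous_on_shift_series:
  fixes c :: "nat \<Rightarrow> complex"
  assumes g: "continuous_on UNIV g" and g0: "\<And>x. x \<le> 0 \<Longrightarrow> g x = 0"
  shows "continuous_on UNIV (\<lambda>x. \<Sum>l. c l * g (x - real l))"
proof -
  have "continuous_on {..<real n} (\<lambda>x. \<Sum>l. c l * g (x - real l))" for n
  proof -
    have "continuous_on {..<real n} (\<lambda>x. \<Sum>l<n. c l * g (x - real l))"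
      by (intro continuous_intros continuous_on_compose2[OF g]) auto
    moreover have "(\<Sum>l. c l * g (x - real l)) = (\<Sum>l<n. c l * g (x - real l))" if "x \<in> {..<real n}"
        for x
      using that by (intro suminf_finite) (auto intro!: g0)
    ultimately show ?thesis by (subst continuous_on_cong[OF refl]) auto
  qed
  then have "continuous_on (\<Union>n. {..<real n}) (\<lambda>x. \<Sum>l. c l * g (x - real l))"
    by (intro continuous_on_open_UN) auto
  moreover have "(\<Union>n. {..<real n}) = UNIV" using reals_Archimedean2 by auto
  ultimately show ?thesis by simp
qed

text \<open>
  Translation by \<open>l\<close> becomes multiplication by \<open>exp (- \<i> \<omega> l)\<close>, so a combination of translates has
  as transform a trigonometric polynomial times that of the common profile.
\<close>

lemma fourier_L1_shift_sum:
  assumes g: "integrable lborel g"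
  shows "fourier_L1 (\<lambda>x. \<Sum>l<N. c l * g (x - real l)) \<omega>
       = (\<Sum>l<N. c l * exp (- \<i> * of_real \<omega> * of_nat l)) * fourier_L1 g \<omega>"
proof -
  let ?h = "\<lambda>x. g x * exp (- \<i> * of_real \<omega> * of_real x)"
  have h: "integrable lborel ?h"
    by (rule Bochner_Integration.integrable_bound[OF g]) (use g in \<open>auto simp: norm_mult\<close>)
  have eq: "c l * g (x - real l) * exp (- \<i> * of_real \<omega> * of_real x)
     = c l * exp (- \<i> * of_real \<omega> * of_nat l) * ?h (- real l + 1 * x)" for l x
    by (simp add: mult_exp_exp algebra_simps)
  have "fourier_L1 (\<lambda>x. \<Sum>l<N. c l * g (x - real l)) \<omega>
      = (LINT x|lborel. (\<Sum>l<N. c l * exp (- \<i> * of_real \<omega> * of_nat l) * ?h (- real l + 1 * x)))"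
    unfolding fourier_L1_def sum_distrib_right eq ..
  also have "\<dots> = (\<Sum>l<N. (LINT x|lborel. c l * exp (- \<i> * of_real \<omega> * of_nat l) * ?h (- real l + 1 * x)))"
    by (intro Bochner_Integration.integral_sum integrable_mult_right lborel_integrable_real_affine h) auto
  also have "\<dots> = (\<Sum>l<N. c l * exp (- \<i> * of_real \<omega> * of_nat l) * fourier_L1 g \<omega>)"
  proof (rule sum.cong)
    fix l
    have "(LINT x|lborel. ?h (- real l + 1 * x)) = fourier_L1 g \<omega>"
      using lborel_integral_real_affine[of 1 ?h "- real l"] by (simp add: fourier_L1_def)
    then show "(LINT x|lborel. c l * exp (- \<i> * of_real \<omega> * of_nat l) * ?h (- real l + 1 * x))
        = c l * exp (- \<i> * of_real \<omega> * of_nat l) * fourier_L1 g \<omega>"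
      by (simp only: integral_mult_right_zero)
  qed simp
  finally show ?thesis by (simp add: sum_distrib_right)
qed

section \<open>Complex powers in the right half-plane\<close>

text \<open>
  The principal power is not multiplicative in general. Here both logarithms have imaginary part
  below \<open>\<pi> / 2\<close> in absolute value, so their difference remains in the principal strip.
\<close>

lemma powr_divide_right_half_plane:
  assumes "Re u > 0" "Re v > 0"
  shows "(u / v) powr z = u powr z * v powr (- z)"
proof -
  have nz: "u \<noteq> 0" "v \<noteq> 0" using assms by auto
  have "\<bar>Im (Ln u)\<bar> < pi / 2" "\<bar>Im (Ln v)\<bar> < pi / 2"
    using assms by (blast intro: Re_Ln_pos_lt_imp)+
  then have "Ln (u / v) = Ln u - Ln v"
    by (intro Ln_unique) (use nz in \<open>auto simp: exp_diff\<close>)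
  with nz show ?thesis by (simp add: powr_def mult_exp_exp right_diff_distrib)
qed

lemma Re_one_minus_exp_pos:
  assumes "Re s > 0"
  shows "Re (1 - exp (- s)) > 0"
proof -
  have "Re (exp (- s)) \<le> cmod (exp (- s))" by (rule complex_Re_le_cmod)
  also have "\<dots> < 1" using assms by simp
  finally show ?thesis by simp
qed

text \<open>
  The argument of \<open>s = a + \<i> \<omega>\<close> is bounded, so \<open>s powr (- z)\<close> decays like \<open>\<bar>s\<bar> powr (- Re z)\<close>; one power
  of \<open>1 / \<bar>s\<bar>\<close> is kept for integrability, and the surplus \<open>Re z - 1\<close> is estimated by its value at
  \<open>\<omega> = 0\<close>.
\<close>

lemma integrable_norm_powr_vertical_line:
  assumes z: "Re z > 1" and a: "a > 0"
  shows "integrable lborel (\<lambda>\<omega>. (cmod ((of_real a + \<i> * of_real \<omega>) powr (- z)))\<^sup>2)"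
proof -
  define K where "K = exp (\<bar>Im z\<bar> * pi) * a powr (1 - Re z)"
  define m where "m = min 1 (a\<^sup>2)"
  have m: "m > 0" using a by (simp add: m_def)
  have bound: "(cmod ((of_real a + \<i> * of_real \<omega>) powr (- z)))\<^sup>2 \<le> K\<^sup>2 / m * inverse (1 + \<omega>\<^sup>2)"
      for \<omega>
  proof -
    define s where "s = of_real a + \<i> * complex_of_real \<omega>"
    have "Re s = a" by (simp add: s_def)
    then have s: "s \<noteq> 0" "cmod s \<ge> a" using a complex_Re_le_cmod[of s] by auto
    have "\<bar>Im (Ln s)\<bar> \<le> pi"
        using s mpi_less_Im_Ln[of s] Im_Ln_le_pi[of s] by (simp add: abs_le_iff)
    then have "\<bar>Im z\<bar> * \<bar>Im (Ln s)\<bar> \<le> \<bar>Im z\<bar> * pi" by (intro mult_left_mono) auto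
    then have "Im z * Im (Ln s) \<le> \<bar>Im z\<bar> * pi"
        using abs_ge_self[of "Im z * Im (Ln s)"] by (simp add: abs_mult)
    moreover have "cmod (s powr (- z)) = exp (Im z * Im (Ln s) + (- Re z) * ln (cmod s))"
      using s by (simp add: powr_def Re_Ln)
    ultimately have "cmod (s powr (- z)) \<le> exp (\<bar>Im z\<bar> * pi) * cmod s powr (- Re z)"
      using s by (simp add: powr_def exp_add[symmetric])
    also have "cmod s powr (- Re z) = cmod s powr (1 - Re z) / cmod s"
      using s powr_add[of "cmod s" "1 - Re z" "-1"] by (simp add: powr_minus divide_inverse)
    also have "\<dots> \<le> a powr (1 - Re z) / cmod s"
      using s a z by (intro divide_right_mono powr_mono2') auto
    finally have "cmod (s powr (- z)) \<le> K / cmod s" by (simp add: K_def)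
    then have "(cmod (s powr (- z)))\<^sup>2 \<le> (K / cmod s)\<^sup>2" by (intro power_mono) auto
    also have "\<dots> = K\<^sup>2 / (a\<^sup>2 + \<omega>\<^sup>2)" by (simp add: power_divide cmod_power2 s_def)
    also have "\<dots> \<le> K\<^sup>2 / (m * (1 + \<omega>\<^sup>2))"
    proof (intro divide_left_mono)
      have "m * 1 \<le> a\<^sup>2" "m * \<omega>\<^sup>2 \<le> 1 * \<omega>\<^sup>2" unfolding m_def by (simp, intro mult_right_mono) auto
      then show "m * (1 + \<omega>\<^sup>2) \<le> a\<^sup>2 + \<omega>\<^sup>2" by (simp add: distrib_left)
      show "0 < (a\<^sup>2 + \<omega>\<^sup>2) * (m * (1 + \<omega>\<^sup>2))"
          using m a by (intro mult_pos_pos add_pos_nonneg) auto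
    qed simp
    finally show ?thesis by (simp add: s_def divide_inverse mult.assoc)
  qed
  have cont: "continuous_on UNIV (\<lambda>\<omega>. (of_real a + \<i> * of_real \<omega>) powr (- z))"
    by (intro continuous_intros) (use a in \<open>auto simp: complex_eq_iff\<close>)
  have "integrable lborel (\<lambda>\<omega>::real. inverse (1 + \<omega>\<^sup>2))"
    using integrable_inverse_1_plus_square by (simp add: set_integrable_def)
  then have "integrable lborel (\<lambda>\<omega>. K\<^sup>2 / m * inverse (1 + \<omega>\<^sup>2))" by simp
  then show ?thesis
  proof (rule Bochner_Integration.integrable_bound)
    show "AE \<omega> in lborel. norm ((cmod ((of_real a + \<i> * of_real \<omega>) powr (- z)))\<^sup>2)
        \<le> norm (K\<^sup>2 / m * inverse (1 + \<omega>\<^sup>2))"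
      using order_trans[OF bound abs_ge_self] by (intro AE_I2) (simp only: real_norm_def abs_power2 abs_norm_cancel)
    show "(\<lambda>\<omega>. (cmod ((of_real a + \<i> * of_real \<omega>) powr (- z)))\<^sup>2) \<in> borel_measurable lborel"
      using borel_measurable_continuous_onI[OF cont] by measurable
  qed
qed

section \<open>The gamma kernel\<close>

text \<open>
  The gamma density of rate \<open>a\<close>, with complex shape parameter \<open>z\<close>. Including the factor \<open>1 / Gamma z\<close>
  here makes its transform exactly \<open>(a + \<i> \<omega>) powr (- z)\<close>.
\<close>

definition gamma_kernel :: "complex \<Rightarrow> real \<Rightarrow> real \<Rightarrow> complex" where
  "gamma_kernel z a x = trunc_power x (z - 1) * exp (- of_real a * of_real x) / Gamma z"

lemma gamma_kernel_nonpos: "x \<le> 0 \<Longrightarrow> gamma_kernel z a x = 0"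
  by (simp add: gamma_kernel_def trunc_power_def)

lemma borel_measurable_gamma_kernel [measurable]: "gamma_kernel z a \<in> borel_measurable borel"
  unfolding gamma_kernel_def [abs_def] by measurable

lemma integrable_gamma_kernel:
  assumes "Re z > 0" "a > 0"
  shows "integrable lborel (gamma_kernel z a)"
  using laplace_trunc_power_real[OF assms] unfolding gamma_kernel_def
  by (auto simp: has_bochner_integral_iff)

lemma square_integrable_gamma_kernel:
  assumes z: "Re z > 1" and a: "a > 0"
  shows "square_integrable (gamma_kernel z a)"
proof -
  \<comment> \<open>The squared modulus is again a gamma density, with shape \<open>2 Re z - 1\<close> and rate \<open>2 a\<close>.\<close>
  let ?z = "complex_of_real (2 * Re z - 1)"
  have "integrable lborel (\<lambda>t. trunc_power t (?z - 1) * exp (- of_real (2 * a) * of_real t))"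
    using laplace_trunc_power_real[of ?z "2 * a"] z a by (auto simp: has_bochner_integral_iff)
  then have "integrable lborel (\<lambda>t. cmod (trunc_power t (?z - 1) * exp (- of_real (2 * a) * of_real t)) / (cmod (Gamma z))\<^sup>2)"
    by (intro integrable_divide integrable_norm)
  moreover have "cmod (trunc_power t (?z - 1) * exp (- of_real (2 * a) * of_real t)) / (cmod (Gamma z))\<^sup>2 = (cmod (gamma_kernel z a t))\<^sup>2" for t
    by (simp add: gamma_kernel_def norm_mult norm_divide norm_trunc_power power_mult_distrib power_divide
          powr_power flip: exp_double)
  ultimately show ?thesis by (simp add: square_integrable_def)
qed

lemma continuous_on_gamma_kernel:
  assumes "Re z > 1"
  shows "continuous_on UNIV (gamma_kernel z a)"
proof -
  have "trunc_power x (z - 1) = of_real (max x 0) powr (z - 1)" for x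
    by (cases "x > 0") (auto simp: trunc_power_eq_powr, simp add: trunc_power_def)
  then have "gamma_kernel z a
      = (\<lambda>x. of_real (max x 0) powr (z - 1) * exp (- of_real a * of_real x) * (1 / Gamma z))"
    by (auto simp: gamma_kernel_def)
  moreover have "continuous_on UNIV (\<lambda>x. of_real (max x 0) powr (z - 1) * exp (- of_real a * of_real x) * (1 / Gamma z))"
    by (intro continuous_intros) (use assms in auto)
  ultimately show ?thesis by simp
qed

lemma fourier_gamma_kernel:
  assumes z: "Re z > 0" and a: "a > 0"
  shows "fourier_L1 (gamma_kernel z a) \<omega> = (of_real a + \<i> * of_real \<omega>) powr (- z)"
proof -
  let ?s = "of_real a + \<i> * complex_of_real \<omega>"
  have "gamma_kernel z a x * exp (- \<i> * of_real \<omega> * of_real x)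
      = trunc_power x (z - 1) * exp (- ?s * of_real x) / Gamma z" for x
    by (simp add: gamma_kernel_def mult.assoc mult_exp_exp algebra_simps)
  then have "fourier_L1 (gamma_kernel z a) \<omega>
      = (LINT x|lborel. trunc_power x (z - 1) * exp (- ?s * of_real x)) / Gamma z"
    unfolding fourier_L1_def by simp
  also have "\<dots> = Gamma z * ?s powr (- z) / Gamma z"
    using laplace_trunc_power[OF z, of ?s] a by simp
  also have "\<dots> = ?s powr (- z)"
    using z by (auto simp: Gamma_eq_zero_iff elim!: nonpos_Ints_cases)
  finally show ?thesis .
qed

section \<open>The binomial coefficients of the spline\<close>

text \<open>
  The coefficients of the binomial series of \<open>(1 - exp (- a) * u) powr z\<close> in powers of \<open>u\<close>; the
  translation operator will be substituted for \<open>u\<close>.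
\<close>

definition bspline_coeff :: "complex \<Rightarrow> real \<Rightarrow> nat \<Rightarrow> complex" where
  "bspline_coeff z a l = (z gchoose l) * (- exp (- of_real a)) ^ l"

lemma complex_binomial_eq_gbinomial:
  assumes "Re z > -1"
  shows "complex_binomial z l = z gchoose l"
proof -
  have "z + 1 \<notin> \<int>\<^sub>\<le>\<^sub>0" using assms by (auto elim!: nonpos_Ints_cases simp: complex_eq_iff)
  moreover have "rGamma (of_nat l + 1 :: complex) = 1 / fact l"
    using Gamma_fact[of l, where ?'a
        = complex] by (simp add: rGamma_inverse_Gamma add.commute divide_inverse)
  ultimately show ?thesis
    by (simp add: complex_binomial_def gbinomial_Gamma rGamma_inverse_Gamma field_simps)
qed

lemma bspline_term_eq:
  assumes z: "Re z > 0"
  shows "1 / Gamma z * bspline_term z a l x = bspline_coeff z a l * gamma_kernel z a (x - real l)"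
proof -
  have "trunc_exp a t * trunc_power t (z - 1)
      = trunc_power t (z - 1) * exp (- of_real a * of_real t)" for t
    by (auto simp: trunc_exp_def trunc_power_def indicator_def simp flip: exp_of_real)
  from this[of "x - real l"]
  have "gamma_kernel z a (x - real l)
      = trunc_exp a (x - real l) * trunc_power (x - real l) (z - 1) / Gamma z"
    by (simp only: gamma_kernel_def)
  moreover have "(- exp (- complex_of_real a)) ^ l = (-1) ^ l * of_real (exp (- real l * a))"
    by (subst power_minus) (simp add: exp_of_nat_mult[symmetric] flip: exp_of_real)
  ultimately show ?thesis
    using z by (simp add: bspline_term_def bspline_coeff_def complex_binomial_eq_gbinomial mult_ac)
qed

lemma summable_norm_bspline_coeff:
  assumes a: "a > 0"
  shows "summable (\<lambda>l. cmod (bspline_coeff z a l))"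
proof -
  \<comment> \<open>The binomial series still converges at the larger point \<open>exp (- a / 2)\<close>, hence absolutely
    at \<open>- exp (- a)\<close>.\<close>
  have "summable (\<lambda>l. (z gchoose l) * (of_real (exp (- a / 2))) ^ l)"
    using a by (intro sums_summable[OF gen_binomial_complex]) simp
  then show ?thesis unfolding bspline_coeff_def
    by (rule powser_insidea) (use a in simp)
qed

text \<open>
  The binomial series applies because \<open>exp (- (a + \<i> \<omega>))\<close> has modulus \<open>exp (- a) < 1\<close>.
\<close>

lemma bspline_symbol_sums:
  assumes a: "a > 0"
  shows "(\<lambda>l. bspline_coeff z a l * exp (- \<i> * of_real \<omega> * of_nat l)) sums
           (1 - exp (- (of_real a + \<i> * of_real \<omega>))) powr z"
proof -
  have "(\<lambda>l. (z gchoose l) * (- exp (- (of_real a + \<i> * of_real \<omega>))) ^ l) sums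
          (1 + - exp (- (of_real a + \<i> * of_real \<omega>))) powr z"
    using a by (intro gen_binomial_complex) simp
  moreover have "(- exp (- (of_real a + \<i> * of_real \<omega>))) ^ l
      = (- exp (- of_real a)) ^ l * exp (- \<i> * of_real \<omega> * of_nat l)" for l
  proof -
    have "- exp (- (of_real a + \<i> * of_real \<omega>)) = (- exp (- of_real a)) * exp (- \<i> * of_real \<omega>)"
      by (simp add: mult_exp_exp)
    moreover have "exp (- \<i> * of_real \<omega>) ^ l = exp (- \<i> * of_real \<omega> * of_nat l)"
      by (simp add: exp_of_nat_mult[symmetric] mult_ac)
    ultimately show ?thesis by (simp only: power_mult_distrib)
  qed
  ultimately show ?thesis by (simp add: bspline_coeff_def mult.assoc)
qed

section \<open>The time domain representation\<close>

text \<open>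
  The transform of a partial sum is a partial sum of the binomial series for \<open>(1 - exp (- s)) powr z\<close>,
  times \<open>s powr (- z)\<close>, where \<open>s
      = a + \<i> \<omega>\<close>. The partial sums of that series are bounded uniformly in
  \<open>\<omega>\<close>, so a multiple of the squared modulus of \<open>s powr (- z)\<close> is an integrable majorant. The limit is
  a power of \<open>Omega\<close> because both \<open>1 - exp (- s)\<close> and \<open>s\<close> lie in the right half-plane.
\<close>

lemma L2_converges_fourier_partial_sums:
  assumes z: "Re z > 1" and a: "a > 0"
  shows "L2_converges (\<lambda>N. fourier_L1 (\<lambda>x. \<Sum>l<N. bspline_coeff z a l * gamma_kernel z a (x - real l)))
           (\<lambda>\<omega>. Omega \<omega> a powr z)"
proof -
  define s where "s \<omega> = of_real a + \<i> * complex_of_real \<omega>" for \<omega>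
  define P where "P N \<omega> = (\<Sum>l<N. bspline_coeff z a l * exp (- \<i> * of_real \<omega> * of_nat l))" for N \<omega>
  define C where "C = (\<Sum>l. cmod (bspline_coeff z a l))"
  have s: "Re (s \<omega>) > 0" for \<omega> using a by (simp add: s_def)
  have ft: "fourier_L1 (\<lambda>x. \<Sum>l<N. bspline_coeff z a l * gamma_kernel z a (x - real l))
      = (\<lambda>\<omega>. P N \<omega> * s \<omega> powr (- z))" for N
    using z a by (intro ext) (simp add: fourier_L1_shift_sum integrable_gamma_kernel fourier_gamma_kernel P_def s_def)
  show ?thesis unfolding ft
  proof (rule L2_converges_dominated)
    show "integrable lborel (\<lambda>\<omega>. C\<^sup>2 * (cmod (s \<omega> powr (- z)))\<^sup>2)"
      using integrable_norm_powr_vertical_line[OF z a] by (simp add: s_def)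
    fix n \<omega>
    have "cmod (P n \<omega>) \<le> (\<Sum>l<n. cmod (bspline_coeff z a l))"
      unfolding P_def by (rule sum_norm_le) (simp add: norm_mult)
    also have "\<dots> \<le> C" unfolding C_def by (intro sum_le_suminf summable_norm_bspline_coeff a) auto
    finally show "(cmod (P n \<omega> * s \<omega> powr (- z)))\<^sup>2 \<le> C\<^sup>2 * (cmod (s \<omega> powr (- z)))\<^sup>2"
      unfolding norm_mult power_mult_distrib by (intro mult_right_mono power_mono) auto
  next
    fix n
    have "continuous_on UNIV (\<lambda>\<omega>. P n \<omega> * s \<omega> powr (- z))"
      unfolding P_def s_def by (intro continuous_intros) (use a in \<open>auto simp: complex_eq_iff\<close>)
    then show "(\<lambda>\<omega>. P n \<omega> * s \<omega> powr (- z)) \<in> borel_measurable lborel"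
      using borel_measurable_continuous_onI by simp
  next
    fix \<omega>
    have "(\<lambda>n. P n \<omega>) \<longlonglongrightarrow> (1 - exp (- s \<omega>)) powr z"
      using bspline_symbol_sums[OF a] by (simp add: P_def s_def sums_def)
    then have "(\<lambda>n. P n \<omega> * s \<omega> powr (- z)) \<longlonglongrightarrow> (1 - exp (- s \<omega>)) powr z * s \<omega> powr (- z)"
      by (rule tendsto_mult_right)
    also have "(1 - exp (- s \<omega>)) powr z * s \<omega> powr (- z) = Omega \<omega> a powr z"
      unfolding Omega_def s_def[symmetric]
      by (rule powr_divide_right_half_plane[symmetric]) (intro Re_one_minus_exp_pos s)+
    finally show "(\<lambda>n. P n \<omega> * s \<omega> powr (- z)) \<longlonglongrightarrow> Omega \<omega> a powr z" .
  qed
qed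

theorem theorem4p7:
  fixes z :: complex and a :: real
  assumes "Re z > 1" and "a > 0"
  shows "(\<forall>x. summable (\<lambda>l. bspline_term z a l x) \<and>
              exp_bspline z a x = 1 / Gamma z * (\<Sum>l. bspline_term z a l x)) \<and>
         L2_converges (\<lambda>N x. 1 / Gamma z * (\<Sum>l<N. bspline_term z a l x)) (exp_bspline z a)"
proof -
  let ?c = "bspline_coeff z a" and ?g = "gamma_kernel z a"
  define E where "E = (\<lambda>x. \<Sum>l. ?c l * ?g (x - real l))"
  have z0: "Re z > 0" using assms by simp
  have summ: "summable (\<lambda>l. bspline_term z a l x)" for x
  proof (rule summable_finite)
    fix l assume "l \<notin> {..<nat \<lceil>x\<rceil>}"
    then have "x - real l \<le> 0" by simp linarith
    then show "bspline_term z a l x = 0" by (simp add: bspline_term_def trunc_power_def)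
  qed simp
  have part: "1 / Gamma z * (\<Sum>l<N. bspline_term z a l x) = (\<Sum>l<N. ?c l * ?g (x - real l))" for N x
    by (simp only: sum_distrib_left bspline_term_eq[OF z0])
  have E_eq: "E x = 1 / Gamma z * (\<Sum>l. bspline_term z a l x)" for x
    unfolding E_def by (simp only: suminf_mult[OF summ, symmetric] bspline_term_eq[OF z0])
  have L2: "L2_converges (\<lambda>N x. \<Sum>l<N. ?c l * ?g (x - real l)) E"
    unfolding E_def using assms
    by (intro L2_converges_shift_series summable_norm_bspline_coeff square_integrable_gamma_kernel gamma_kernel_nonpos)
  have cont: "continuous_on UNIV E"
    unfolding E_def using assms by (intro continuous_on_shift_series continuous_on_gamma_kernel gamma_kernel_nonpos)
  have ft: "is_fourier_L2 E (\<lambda>\<omega>. Omega \<omega> a powr z)"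
    unfolding is_fourier_L2_def
  proof (intro exI conjI allI)
    have "integrable lborel (\<lambda>x. ?g (x - real l))" for l
      using lborel_integrable_real_affine[OF integrable_gamma_kernel[OF z0 assms(2)],
          of 1 "- real l"] by simp
    then show "integrable lborel (\<lambda>x. \<Sum>l<n. ?c l * ?g (x - real l))" for n by simp
  qed (use L2 L2_converges_fourier_partial_sums[OF assms] in simp_all)
  have "exp_bspline z a = E"
    unfolding exp_bspline_def
  proof (rule the_equality)
    show "E' = E" if "continuous_on UNIV E' \<and> is_fourier_L2 E' (\<lambda>\<omega>. Omega \<omega> a powr z)" for E'
      using is_fourier_L2_continuous_unique that ft cont by blast
  qed (use cont ft in simp)
  then show ?thesis using summ E_eq L2 by (simp only: part simp_thms)
qed

end
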